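(* Let $R$ be a principal ideal domain and let $I=gR\subsetneq R$ be a proper, non-prime ideal such that $Q:=R/I$ is finite. Suppose that $g$ has exactly one prime factor up to association, i.e. $g=u\cdot p_1^{m_1}$ with $u$ a unit, $p_1$ a prime element and $m_1\ge 1$ an integer. Then the zero divisor graph $\Gamma(Q)$ satisfies \[\dim_{TH}(\Gamma(Q))=\mathrm{box}(\Gamma(Q))=\begin{cases}0 & \text{if } m_1\le 2,\\ 1 & \text{if } m_1\ge 3.\end{cases}\]
   Context: Rings are commutative and non-zero with $1$. For a ring $Q$, $Z(Q)$ is the set of $r\in Q$ for which there is $s\in Q\setminus\{0\}$ with $rs=0$. The zero divisor graph $\Gamma(Q)$ has vertex set $Z(Q)\setminus\{0\}$; two distinct vertices $r,s$ are adjacent iff $rs=0$. The boxicity $\mathrm{box}(G)$ of a finite simple graph $G$ is the minimum integer $d\ge 0$ such that there exist $d$ interval graphs $I_1,\dots,I_d$ on $V(G)$ with $E(G)=\bigcap_{j=1}^d E(I_j)$. For a finite set $V$, $\alpha\colon V\to\mathbb{R}$ and $S\in\mathbb{R}$, the threshold graph $T(\alpha,S)$ has vertex set $V$ and edges all $\{v,w\}$, $v\neq w$, with $\alpha(v)+\alpha(w)\ge S$; a graph is a threshold graph if it is of this form. The threshold dimension $\dim_{TH}(G)$ is the minimum $d\ge 0$ such that there exist $d$ threshold graphs $H_1,\dots,H_d$ on $V(G)$ with $E(G)=\bigcap_{j=1}^d E(H_j)$. In both definitions the empty intersection ($d=0$) is the set of all pairs of vertices, so the parameter is $0$ exactly for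 complete graphs (including the graph with no vertices). *)

theory Defs
  imports "HOL-Algebra.Ring_Divisibility" "Graph_Theory.Pair_Digraph"
begin

text \<open>
  Finite simple graphs are the \<^locale>\<open>pair_graph\<close>s of the Graph Theory entry: an undirected edge
  is represented by the two ordered pairs of its (distinct) ends.
\<close>

section \<open>Zero divisor graphs\<close>

text \<open>The zero element counts as a zero divisor (in a non-zero ring).\<close>

definition zero_divisors :: "('a, 'b) ring_scheme \<Rightarrow> 'a set" where
  "zero_divisors Q =
     {r \<in> carrier Q. \<exists>s \<in> carrier Q - {\<zero>\<^bsub>Q\<^esub>}. r \<otimes>\<^bsub>Q\<^esub> s = \<zero>\<^bsub>Q\<^esub>}"

definition zero_divisor_graph :: "('a, 'b) ring_scheme \<Rightarrow> 'a pair_pre_digraph" where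
  "zero_divisor_graph Q =
     \<lparr>pverts = zero_divisors Q - {\<zero>\<^bsub>Q\<^esub>},
      parcs = {(r, s). r \<in> zero_divisors Q - {\<zero>\<^bsub>Q\<^esub>} \<and> s \<in> zero_divisors Q - {\<zero>\<^bsub>Q\<^esub>} \<and>
                       r \<noteq> s \<and> r \<otimes>\<^bsub>Q\<^esub> s = \<zero>\<^bsub>Q\<^esub>}\<rparr>"

section \<open>Interval graphs and threshold graphs\<close>

text \<open>Intersection graphs of nonempty compact real intervals.\<close>

definition is_interval_graph :: "'v pair_pre_digraph \<Rightarrow> bool" where
  "is_interval_graph G \<longleftrightarrow> pair_graph G \<and>
     (\<exists>l r :: 'v \<Rightarrow> real.
        (\<forall>v \<in> pverts G. l v \<le> r v) \<and>
        (\<forall>v \<in> pverts G. \<forall>w \<in> pverts G. v \<noteq> w \<longrightarrow>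
           ((v, w) \<in> parcs G \<longleftrightarrow> {l v..r v} \<inter> {l w..r w} \<noteq> {})))"

definition threshold_graph :: "'v set \<Rightarrow> ('v \<Rightarrow> real) \<Rightarrow> real \<Rightarrow> 'v pair_pre_digraph" where
  "threshold_graph V \<alpha> S =
     \<lparr>pverts = V, parcs = {(v, w). v \<in> V \<and> w \<in> V \<and> v \<noteq> w \<and> \<alpha> v + \<alpha> w \<ge> S}\<rparr>"

definition is_threshold_graph :: "'v pair_pre_digraph \<Rightarrow> bool" where
  "is_threshold_graph G \<longleftrightarrow> (\<exists>V \<alpha> S. finite V \<and> G = threshold_graph V \<alpha> S)"

section \<open>Boxicity and threshold dimension\<close>

definition all_pairs :: "'v set \<Rightarrow> 'v rel" where
  "all_pairs V = {(v, w). v \<in> V \<and> w \<in> V \<and> v \<noteq> w}"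

text \<open>
  \<open>is_intersection_of P G d\<close>: \<open>G\<close> is the intersection of \<open>d\<close> graphs of the class \<open>P\<close> on its own
  vertex set. The intersection is taken inside \<^const>\<open>all_pairs\<close>, which fixes the meaning of the
  empty intersection; it is redundant for \<open>d > 0\<close> when \<open>P\<close> consists of simple graphs.
\<close>

definition is_intersection_of ::
    "('v pair_pre_digraph \<Rightarrow> bool) \<Rightarrow> 'v pair_pre_digraph \<Rightarrow> nat \<Rightarrow> bool" where
  "is_intersection_of P G d \<longleftrightarrow>
     (\<exists>H :: nat \<Rightarrow> 'v pair_pre_digraph.
        (\<forall>j < d. P (H j) \<and> pverts (H j) = pverts G) \<and>
        parcs G = all_pairs (pverts G) \<inter> (\<Inter>j < d. parcs (H j)))"

text \<open>
  For a finite simple graph the minima below are attained; see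
  \<open>is_intersection_of_threshold_graphs_ex\<close> and \<open>is_intersection_of_interval_graphs_ex\<close>.
\<close>

definition boxicity :: "'v pair_pre_digraph \<Rightarrow> nat" where
  "boxicity G = (LEAST d. is_intersection_of is_interval_graph G d)"

definition threshold_dim :: "'v pair_pre_digraph \<Rightarrow> nat" where
  "threshold_dim G = (LEAST d. is_intersection_of is_threshold_graph G d)"

section \<open>Well-definedness\<close>

lemma pair_graphI:
  assumes "finite V" "E \<subseteq> all_pairs V" "sym E"
  shows "pair_graph \<lparr>pverts = V, parcs = E\<rparr>"
proof -
  have "finite (V \<times> V)" using assms by simp
  moreover have "E \<subseteq> V \<times> V" using assms by (auto simp: all_pairs_def)
  ultimately have "finite E" by (rule rev_finite_subset)
  then show ?thesis
    using assms
    by unfold_locales (auto simp: all_pairs_def symmetric_def)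
qed

lemma pair_graph_zero_divisor_graph:
  assumes "cring Q" "finite (carrier Q)"
  shows "pair_graph (zero_divisor_graph Q)"
proof -
  interpret cring Q by fact
  have "finite (zero_divisors Q)"
    using assms(2) by (auto simp: zero_divisors_def)
  then show ?thesis
    unfolding zero_divisor_graph_def
    by (intro pair_graphI) (auto simp: all_pairs_def zero_divisors_def m_comm intro!: symI)
qed

lemma pair_graph_threshold_graph: "finite V \<Longrightarrow> pair_graph (threshold_graph V \<alpha> S)"
  unfolding threshold_graph_def
  by (intro pair_graphI) (auto simp: all_pairs_def add.commute intro!: symI)

lemma is_threshold_graph_imp_is_interval_graph:
  assumes "is_threshold_graph G"
  shows "is_interval_graph G"
proof -
  obtain V \<alpha> S where V: "finite V" and G: "G = threshold_graph V \<alpha> S"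
    using assms by (auto simp: is_threshold_graph_def)
  obtain f :: "'a \<Rightarrow> nat" where f: "inj_on f V"
    using V finite_imp_inj_to_nat_seg by blast
  \<comment> \<open>Vertices of weight at least \<open>S / 2\<close> get intervals starting at \<open>0\<close>; the
      others get distinct positive points, heavier ones closer to \<open>0\<close>.\<close>
  have "\<exists>p :: 'a \<Rightarrow> real. inj_on p V \<and> (\<forall>v\<in>V. p v > 0) \<and>
      (\<forall>v\<in>V. \<forall>w\<in>V. \<alpha> w < \<alpha> v \<longrightarrow> p v < p w)"
  proof -
    define c where "c v = card {w \<in> V. \<alpha> w > \<alpha> v \<or> (\<alpha> w = \<alpha> v \<and> f w \<le> f v)}" for v
    let ?A = "\<lambda>v. {w \<in> V. \<alpha> w > \<alpha> v \<or> (\<alpha> w = \<alpha> v \<and> f w \<le> f v)}"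
    have lt: "c v < c w" if "v \<in> V" "w \<in> V" "\<alpha> w < \<alpha> v \<or> (\<alpha> w = \<alpha> v \<and> f v < f w)" for v w
      unfolding c_def
    proof (rule psubset_card_mono)
      show "finite (?A w)" using V by simp
      have "w \<in> ?A w" "w \<notin> ?A v" using that by auto
      moreover have "?A v \<subseteq> ?A w" using that by auto
      ultimately show "?A v \<subset> ?A w" by blast
    qed
    have "inj_on c V"
    proof (rule inj_onI)
      fix v w assume *: "v \<in> V" "w \<in> V" "c v = c w"
      show "v = w"
      proof (rule ccontr)
        assume "v \<noteq> w"
        then have "f v \<noteq> f w" using f * by (auto simp: inj_on_def)
        then consider "\<alpha> w < \<alpha> v \<or> (\<alpha> w = \<alpha> v \<and> f v < f w)"
          | "\<alpha> v < \<alpha> w \<or> (\<alpha> v = \<alpha> w \<and> f w < f v)" by linarith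
        then show False using lt[of v w] lt[of w v] * by cases auto
      qed
    qed
    moreover have "c v > 0" if "v \<in> V" for v
      unfolding c_def using V that by (auto simp: card_gt_0_iff)
    ultimately show ?thesis
      using lt by (intro exI[of _ "\<lambda>v. real (c v)"]) (auto simp: inj_on_def)
  qed
  then obtain p :: "'a \<Rightarrow> real" where p: "inj_on p V" "\<And>v. v \<in> V \<Longrightarrow> p v > 0"
    "\<And>v w. v \<in> V \<Longrightarrow> w \<in> V \<Longrightarrow> \<alpha> w < \<alpha> v \<Longrightarrow> p v < p w" by blast
  define R where "R v = Max (insert 0 (p ` {w \<in> V. \<alpha> v + \<alpha> w \<ge> S}))" for v
  define l where "l v = (if 2 * \<alpha> v \<ge> S then 0 else p v)" for v
  define r where "r v = (if 2 * \<alpha> v \<ge> S then R v else p v)" for v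
  have R0: "R v \<ge> 0" for v unfolding R_def using V by (intro Max_ge) auto
  have R: "p w \<le> R v \<longleftrightarrow> \<alpha> v + \<alpha> w \<ge> S" if "v \<in> V" "w \<in> V" for v w
  proof
    assume "\<alpha> v + \<alpha> w \<ge> S"
    then show "p w \<le> R v" unfolding R_def using V that by (intro Max_ge) auto
  next
    assume *: "p w \<le> R v"
    have "R v \<in> insert 0 (p ` {w \<in> V. \<alpha> v + \<alpha> w \<ge> S})"
      unfolding R_def using V by (intro Max_in) auto
    moreover have "R v \<noteq> 0" using p(2)[OF that(2)] * by linarith
    ultimately obtain x where x: "x \<in> V" "\<alpha> v + \<alpha> x \<ge> S" "R v = p x" by auto
    have "\<not> \<alpha> w < \<alpha> x" using p(3)[of x w] x that * by auto
    then show "\<alpha> v + \<alpha> w \<ge> S" using x by linarith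
  qed
  have "(v, w) \<in> parcs G \<longleftrightarrow> {l v..r v} \<inter> {l w..r w} \<noteq> {}"
    if vw: "v \<in> V" "w \<in> V" "v \<noteq> w" for v w
  proof -
    have E: "(v, w) \<in> parcs G \<longleftrightarrow> \<alpha> v + \<alpha> w \<ge> S"
      using vw by (simp add: G threshold_graph_def)
    have pne: "p v \<noteq> p w" using p(1) vw by (auto simp: inj_on_def)
    consider "2 * \<alpha> v \<ge> S" "2 * \<alpha> w \<ge> S" | "2 * \<alpha> v \<ge> S" "\<not> 2 * \<alpha> w \<ge> S"
      | "\<not> 2 * \<alpha> v \<ge> S" "2 * \<alpha> w \<ge> S" | "\<not> 2 * \<alpha> v \<ge> S" "\<not> 2 * \<alpha> w \<ge> S" by blast
    then show ?thesis
    proof cases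
      case 1
      then have "\<alpha> v + \<alpha> w \<ge> S" by linarith
      moreover have "0 \<in> {l v..r v} \<inter> {l w..r w}"
        using 1 R0 by (simp add: l_def r_def)
      ultimately show ?thesis using E by blast
    next
      case 2
      then show ?thesis using E R[OF vw(1,2)] p(2)[OF vw(2)] by (auto simp: l_def r_def)
    next
      case 3
      then show ?thesis using E R[OF vw(2,1)] p(2)[OF vw(1)]
        by (auto simp: l_def r_def add.commute)
    next
      case 4
      then show ?thesis using E pne by (auto simp: l_def r_def)
    qed
  qed
  moreover have "l v \<le> r v" for v using R0 by (simp add: l_def r_def)
  moreover have "pverts G = V" by (simp add: G threshold_graph_def)
  ultimately show ?thesis
    unfolding is_interval_graph_def using pair_graph_threshold_graph[OF V] G
    by (intro conjI exI[of _ l] exI[of _ r]) auto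
qed

lemma is_intersection_of_0: "is_intersection_of P G 0 \<longleftrightarrow> parcs G = all_pairs (pverts G)"
  by (simp add: is_intersection_of_def)

lemma is_intersection_of_threshold_graphs_ex:
  assumes "pair_graph G"
  shows "\<exists>d. is_intersection_of is_threshold_graph G d"
proof -
  interpret pair_graph G by fact
  define N where "N = all_pairs (pverts G) - parcs G"
  have "N \<subseteq> pverts G \<times> pverts G" by (auto simp: N_def all_pairs_def)
  then have "finite N" using pair_finite_verts finite_subset by blast
  then obtain h :: "nat \<Rightarrow> 'a \<times> 'a" and d where h: "N = h ` {..<d}"
    by (metis finite_imp_nat_seg_image_inj_on lessThan_def)
  define H where
    "H j = threshold_graph (pverts G) (\<lambda>x. if x \<in> {fst (h j), snd (h j)} then 0 else 1) 1" for j
  have sub: "parcs G \<subseteq> all_pairs (pverts G)"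
    using wellformed' pair_no_loops by (fastforce simp: all_pairs_def)
  have symG: "(b, a) \<in> parcs G" if "(a, b) \<in> parcs G" for a b
    using pair_sym_arcs that by (auto simp: symmetric_def dest: symD)
  have HE: "parcs (H j) = all_pairs (pverts G) - {h j, prod.swap (h j)}" if "j < d" for j
  proof -
    have "h j \<in> N" using h that by blast
    then have "fst (h j) \<noteq> snd (h j)" by (auto simp: N_def all_pairs_def)
    then show ?thesis
      by (cases "h j") (auto simp: H_def threshold_graph_def all_pairs_def)
  qed
  have "parcs G = all_pairs (pverts G) \<inter> (\<Inter>j<d. parcs (H j))"
  proof (intro equalityI subsetI)
    fix e assume e: "e \<in> parcs G"
    have "e \<in> parcs (H j)" if "j < d" for j
    proof -
      have "h j \<notin> parcs G" using h that by (auto simp: N_def)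
      moreover from this have "prod.swap (h j) \<notin> parcs G"
        using symG by (cases "h j") auto
      ultimately show ?thesis using HE[OF that] e sub by auto
    qed
    then show "e \<in> all_pairs (pverts G) \<inter> (\<Inter>j<d. parcs (H j))" using e sub by auto
  next
    fix e assume e: "e \<in> all_pairs (pverts G) \<inter> (\<Inter>j<d. parcs (H j))"
    show "e \<in> parcs G"
    proof (rule ccontr)
      assume "e \<notin> parcs G"
      then have "e \<in> N" using e by (simp add: N_def)
      then obtain j where j: "j < d" "e = h j" using h by auto
      then have "e \<in> parcs (H j)" using e by blast
      then show False using HE[OF j(1)] j(2) by simp
    qed
  qed
  moreover have "is_threshold_graph (H j) \<and> pverts (H j) = pverts G" for j
    using pair_finite_verts unfolding is_threshold_graph_def H_def
    by (intro conjI exI) (rule pair_finite_verts, rule refl, simp add: threshold_graph_def)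
  ultimately show ?thesis unfolding is_intersection_of_def by blast
qed

lemma is_intersection_of_interval_graphs_ex:
  assumes "pair_graph G"
  shows "\<exists>d. is_intersection_of is_interval_graph G d"
  using is_intersection_of_threshold_graphs_ex[OF assms] is_threshold_graph_imp_is_interval_graph
  unfolding is_intersection_of_def by blast

end

theory Submission
  imports Defs
begin

text \<open>
  Let \<open>v\<close> be the \<open>p\<close>-adic valuation truncated at \<open>m\<close>. Since \<open>p\<close> is prime, two elements of \<open>R/I\<close>
  have product zero iff \<open>v x + v y \<ge> m\<close>, so the zero divisor graph is itself a threshold graph with
  weights \<open>v\<close>, and both parameters are \<open>0\<close> or \<open>1\<close> according to whether it is complete. Vertices
  have \<open>v \<ge> 1\<close>, which makes the graph complete for \<open>m \<le> 2\<close>; for \<open>m \<ge> 3\<close> the vertices \<open>p\<close> and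
  \<open>p + p^(m - 1)\<close> are not adjacent.
\<close>

section \<open>Divisibility by powers of a prime element\<close>

lemma (in monoid) one_divides: "a \<in> carrier G \<Longrightarrow> \<one> divides a"
  by (rule dividesI[of a]) simp_all

text \<open>Induction on \<open>m\<close>: a prime dividing \<open>a \<otimes> b\<close> divides one
  of the two factors. Cancelling one \<open>p\<close> from that factor, which is possible since
  \<open>p\<close> is nonzero in a domain, leaves a product divisible by the next lower
  power.\<close>

lemma (in domain) prime_pow_divides_multE:
  assumes "ring_prime p" "p \<in> carrier R" "a \<in> carrier R" "b \<in> carrier R"
    and "p [^] (m::nat) divides a \<otimes> b"
  obtains i j where "i + j = m" "p [^] i divides a" "p [^] j divides b"
proof -
  have p: "p \<noteq> \<zero>" "prime R p"
    using assms(1) by (auto simp: ring_prime_def)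
  have cancel: "x divides y"
    if "p \<otimes> x divides p \<otimes> y" "x \<in> carrier R" "y \<in> carrier R" for x y
    using that p(1) assms(2) by (auto simp: factor_def m_assoc m_lcancel)
  have "\<exists>i j. i + j = m \<and> p [^] i divides a \<and> p [^] j divides b"
    using assms(3-5)
  proof (induction m arbitrary: a b)
    case 0
    then show ?case using one_divides by simp
  next
    case (Suc m)
    have pow: "p [^] Suc m = p \<otimes> p [^] m" for m
      using assms(2) by (simp only: nat_pow_Suc2)
    have "p divides p [^] Suc m"
      using assms(2) unfolding pow by (intro divides_prod_r) auto
    then have "p divides a \<otimes> b"
      using Suc.prems(3) assms(2) divides_trans by blast
    then consider "p divides a" | "p divides b"
      using p(2) Suc.prems by (auto simp: prime_def)
    then show ?case
    proof cases
      case 1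
      then obtain a' where a': "a' \<in> carrier R" "a = p \<otimes> a'" by (auto simp: factor_def)
      then have "p [^] m divides a' \<otimes> b"
        using Suc.prems cancel[of "p [^] m" "a' \<otimes> b"] assms(2) by (simp only: pow) (simp add: m_assoc)
      from Suc.IH[OF a'(1) Suc.prems(2) this] obtain i j
        where ij: "i + j = m" "p [^] i divides a'" "p [^] j divides b" by auto
      then have "p [^] Suc i divides a"
        unfolding pow a'(2) using a'(1) assms(2) by (intro divides_mult_lI) auto
      then show ?thesis using ij by (intro exI[of _ "Suc i"] exI[of _ j]) simp
    next
      case 2
      then obtain b' where b': "b' \<in> carrier R" "b = p \<otimes> b'" by (auto simp: factor_def)
      then have "p [^] m divides a \<otimes> b'"
        using Suc.prems cancel[of "p [^] m" "a \<otimes> b'"] assms(2) by (simp only: pow) (simp add: m_lcomm)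
      from Suc.IH[OF Suc.prems(1) b'(1) this] obtain i j
        where ij: "i + j = m" "p [^] i divides a" "p [^] j divides b'" by auto
      then have "p [^] Suc j divides b"
        unfolding pow b'(2) using b'(1) assms(2) by (intro divides_mult_lI) auto
      then show ?thesis using ij by (intro exI[of _ i] exI[of _ "Suc j"]) simp
    qed
  qed
  then show thesis using that by blast
qed

text \<open>The bound \<open>m\<close> ensures that the maximum exists also for \<open>a = 0\<close>.\<close>

definition val_below :: "('a, 'b) ring_scheme \<Rightarrow> 'a \<Rightarrow> nat \<Rightarrow> 'a \<Rightarrow> nat" where
  "val_below R p m a = Max {k. k \<le> m \<and> p [^]\<^bsub>R\<^esub> k divides\<^bsub>R\<^esub> a}"

context domain
begin

lemma val_below_ge:
  assumes "k \<le> m" "p [^] k divides a"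
  shows "k \<le> val_below R p m a"
  unfolding val_below_def using assms by (intro Max_ge) auto

lemma pow_val_below_divides:
  assumes "a \<in> carrier R"
  shows "p [^] val_below R p m a divides a"
proof -
  \<comment> \<open>The exponent \<open>0\<close> always qualifies, so the maximum is taken over a
    nonempty finite set and is attained.\<close>
  have "0 \<in> {k. k \<le> m \<and> p [^] k divides a}"
    using assms one_divides by simp
  then have "val_below R p m a \<in> {k. k \<le> m \<and> p [^] k divides a}"
    unfolding val_below_def by (intro Max_in) auto
  then show ?thesis by simp
qed

lemma pow_divides_pow:
  assumes "p \<in> carrier R" "k \<le> n"
  shows "p [^] (k::nat) divides p [^] (n::nat)"
proof (rule dividesI)
  show "p [^] (n - k) \<in> carrier R" using assms by simp
  show "p [^] n = p [^] k \<otimes> p [^] (n - k)" using assms by (simp add: nat_pow_mult)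
qed

text \<open>Splitting \<open>p [^] m\<close> over the two factors gives exponents with sum
  \<open>m\<close>. Each is at most \<open>m\<close>, so truncation at \<open>m\<close> does not
  lose it. Conversely, the powers of \<open>p\<close> dividing the factors multiply.\<close>

lemma prime_pow_divides_mult_iff:
  assumes "ring_prime p" "p \<in> carrier R" "a \<in> carrier R" "b \<in> carrier R"
  shows "p [^] m divides a \<otimes> b \<longleftrightarrow> m \<le> val_below R p m a + val_below R p m b"
    (is "_ \<longleftrightarrow> m \<le> ?i + ?j")
proof
  assume "p [^] m divides a \<otimes> b"
  with assms obtain i j where ij: "i + j = m" "p [^] i divides a" "p [^] j divides b"
    by (rule prime_pow_divides_multE)
  then show "m \<le> ?i + ?j"
    using val_below_ge[of i m p a] val_below_ge[of j m p b] by simp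
next
  assume "m \<le> ?i + ?j"
  then have "p [^] m divides p [^] (?i + ?j)" using assms by (intro pow_divides_pow)
  also have "p [^] (?i + ?j) = p [^] ?i \<otimes> p [^] ?j" using assms by (simp add: nat_pow_mult)
  finally have 1: "p [^] m divides p [^] ?i \<otimes> p [^] ?j" .
  have "p [^] ?i \<otimes> p [^] ?j divides p [^] ?i \<otimes> b"
    using assms by (intro divides_mult_lI pow_val_below_divides) auto
  moreover have "p [^] ?i \<otimes> b divides a \<otimes> b"
    using assms by (intro divides_mult_rI pow_val_below_divides) auto
  ultimately show "p [^] m divides a \<otimes> b" using 1 assms
    by (meson divides_trans m_closed nat_pow_closed)
qed

text \<open>If a larger power divided a smaller one, \<open>p [^] Suc k\<close> would divide
  \<open>p [^] k\<close>, and cancelling \<open>p [^] k\<close> would make the prime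
  \<open>p\<close> a unit.\<close>

lemma prime_pow_divides_pow_iff:
  assumes "ring_prime p" "p \<in> carrier R"
  shows "p [^] (n::nat) divides p [^] (k::nat) \<longleftrightarrow> n \<le> k"
proof
  assume *: "p [^] n divides p [^] k"
  show "n \<le> k"
  proof (rule ccontr)
    assume "\<not> n \<le> k"
    then have "p [^] Suc k divides p [^] n" using assms(2) by (intro pow_divides_pow) auto
    then have "p [^] Suc k divides p [^] k"
      using * assms(2) divides_trans nat_pow_closed by blast
    then obtain c where c: "c \<in> carrier R" "p [^] k = p [^] k \<otimes> p \<otimes> c"
      by (auto simp: factor_def)
    have "p [^] k \<noteq> \<zero>"
      using assms by (induction k) (auto simp: ring_prime_def integral_iff)
    then have "\<one> = p \<otimes> c"
      using c assms(2) m_lcancel[of "p [^] k" "\<one>" "p \<otimes> c"] by (simp add: m_assoc)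
    then have "p \<in> Units R" using c(1) assms(2) by (metis divides_one factor_def)
    then show False using assms(1) by (simp add: ring_prime_def prime_def)
  qed
qed (use assms pow_divides_pow in blast)

text \<open>If \<open>a\<close> contributed no factor \<open>p\<close>, all \<open>m\<close> factors
  would have to come from \<open>b\<close>. Applied to a zero divisor \<open>a\<close> and its
  annihilator \<open>b\<close>, this bounds the weight of a vertex from below.\<close>

lemma val_below_ge_1_of_divides_mult:
  assumes "ring_prime p" "p \<in> carrier R" "a \<in> carrier R" "b \<in> carrier R"
    and "p [^] m divides a \<otimes> b" "\<not> p [^] m divides b"
  shows "1 \<le> val_below R p m a"
proof (rule ccontr)
  assume "\<not> 1 \<le> val_below R p m a"
  then have "m \<le> val_below R p m b"
    using assms prime_pow_divides_mult_iff[of p a b m] by simp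
  then have "p [^] m divides p [^] val_below R p m b"
    using assms by (intro pow_divides_pow)
  then show False
    using assms pow_val_below_divides[of b p m] divides_trans nat_pow_closed by blast
qed

end

section \<open>Zero products and zero divisors in a quotient ring, in terms of
  representatives\<close>

lemma (in ideal) Quot_eq_zero_iff:
  assumes "a \<in> carrier R"
  shows "I +> a = \<zero>\<^bsub>R Quot I\<^esub> \<longleftrightarrow> a \<in> I"
  using assms a_rcos_self[of a] a_rcos_const[of a] by (auto simp: FactRing_def)

lemma (in ideal) Quot_mult_cosets:
  assumes "a \<in> carrier R" "b \<in> carrier R"
  shows "(I +> a) \<otimes>\<^bsub>R Quot I\<^esub> (I +> b) = I +> (a \<otimes> b)"
  using assms by (simp add: FactRing_def rcoset_mult_add)

lemma (in ideal) zero_divisors_Quot_iff: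
  assumes "a \<in> carrier R"
  shows "I +> a \<in> zero_divisors (R Quot I) \<longleftrightarrow> (\<exists>b \<in> carrier R. b \<notin> I \<and> a \<otimes> b \<in> I)"
proof -
  have carr: "carrier (R Quot I) = (\<lambda>a. I +> a) ` carrier R"
    by (auto simp: FactRing_def A_RCOSETS_def')
  have "I +> a \<in> zero_divisors (R Quot I) \<longleftrightarrow>
      (\<exists>b \<in> carrier R. I +> b \<noteq> \<zero>\<^bsub>R Quot I\<^esub> \<and> (I +> a) \<otimes>\<^bsub>R Quot I\<^esub> (I +> b) = \<zero>\<^bsub>R Quot I\<^esub>)"
    unfolding zero_divisors_def carr using assms by auto
  also have "\<dots> \<longleftrightarrow> (\<exists>b \<in> carrier R. b \<notin> I \<and> a \<otimes> b \<in> I)"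
    using assms Quot_mult_cosets Quot_eq_zero_iff by (intro bex_cong) simp_all
  finally show ?thesis .
qed

section \<open>Both parameters for a graph that is itself a threshold graph\<close>

lemma is_intersection_of_1:
  assumes "P G" "pair_graph G"
  shows "is_intersection_of P G 1"
proof -
  interpret pair_graph G by fact
  have "parcs G \<subseteq> all_pairs (pverts G)"
    using wellformed' pair_no_loops by (fastforce simp: all_pairs_def)
  then show ?thesis
    unfolding is_intersection_of_def using assms(1)
    by (intro exI[of _ "\<lambda>_. G"]) auto
qed

text \<open>The empty intersection represents exactly the complete graphs; any other graph in the
  class is represented by itself alone.\<close>

lemma Least_is_intersection_of:
  assumes "P G" "pair_graph G"
  shows "(LEAST d. is_intersection_of P G d) = (if parcs G = all_pairs (pverts G) then 0 else 1)"
proof (cases "parcs G = all_pairs (pverts G)")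
  case True
  then show ?thesis using is_intersection_of_0[of P G] by simp
next
  case False
  then have "1 \<le> d" if "is_intersection_of P G d" for d
    using that is_intersection_of_0[of P G] by (cases d) auto
  then have "(LEAST d. is_intersection_of P G d) = 1"
    using is_intersection_of_1[of P, OF assms] by (intro Least_equality)
  then show ?thesis using False by simp
qed

text \<open>A threshold graph is also an interval graph, so the same argument computes both
  minima.\<close>

lemma threshold_graph_dims:
  assumes "is_threshold_graph G"
  shows "threshold_dim G = (if parcs G = all_pairs (pverts G) then 0 else 1)"
    and "boxicity G = (if parcs G = all_pairs (pverts G) then 0 else 1)"
proof -
  have I: "is_interval_graph G" by (rule is_threshold_graph_imp_is_interval_graph[OF assms])
  then have "pair_graph G" by (simp add: is_interval_graph_def)
  then show "threshold_dim G = (if parcs G = all_pairs (pverts G) then 0 else 1)"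
    and "boxicity G = (if parcs G = all_pairs (pverts G) then 0 else 1)"
    unfolding threshold_dim_def boxicity_def
    using Least_is_intersection_of assms I by blast+
qed

section \<open>The zero divisor graph of the quotient by a prime power\<close>

theorem lemma77:
  fixes R :: "('a, 'b) ring_scheme" (structure)
    and I :: "'a set" and g u p :: 'a and m :: nat
  assumes "principal_domain R"
    and "g \<in> carrier R" and "I = PIdl g"
    and "I \<subset> carrier R" and "\<not> primeideal I R"
    and "finite (carrier (R Quot I))"
    and "u \<in> Units R" and "p \<in> carrier R" and "ring_prime p" and "m \<ge> 1"
    and "g = u \<otimes> p [^] m"
  shows "threshold_dim (zero_divisor_graph (R Quot I)) = boxicity (zero_divisor_graph (R Quot I))
       \<and> boxicity (zero_divisor_graph (R Quot I)) = (if m \<le> 2 then 0 else 1)"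
proof -
  interpret principal_domain R by fact
  interpret ideal I R using assms(2,3) by (simp add: cgenideal_ideal)
  note p = \<open>ring_prime p\<close> \<open>p \<in> carrier R\<close>
  let ?G = "zero_divisor_graph (R Quot I)"
  \<comment> \<open>The unit \<open>u\<close> does not affect divisibility, so membership in
    \<open>I\<close> becomes divisibility by \<open>p [^] m\<close>.\<close>
  have "g \<sim> p [^] m"
  proof (rule associatedI2)
    show "g = p [^] m \<otimes> u" using assms(7,11) p(2) by (simp add: m_comm Units_closed)
  qed (use assms(7) p(2) in simp_all)
  then have g: "g divides p [^] m" "p [^] m divides g" by (simp_all add: associated_def)
  have I: "a \<in> I \<longleftrightarrow> p [^] m divides a" if "a \<in> carrier R" for a
  proof -
    have "a \<in> I \<longleftrightarrow> (\<exists>c \<in> carrier R. a = c \<otimes> g)"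
      unfolding assms(3) cgenideal_def by blast
    also have "\<dots> \<longleftrightarrow> g divides a"
      unfolding factor_def by (intro bex_cong refl) (metis assms(2) m_comm)
    finally show ?thesis
      using g that p(2) assms(2)
      by (meson divides_trans nat_pow_closed)
  qed
  \<comment> \<open>The weight of a coset is read off one fixed representative; the criterion
    \<open>mult\<close> holds for whichever one is chosen.\<close>
  define rep where "rep X = (SOME a. a \<in> carrier R \<and> I +> a = X)" for X
  have rep: "rep X \<in> carrier R \<and> I +> rep X = X" if "X \<in> carrier (R Quot I)" for X
    unfolding rep_def by (rule someI_ex) (use that in \<open>auto simp: FactRing_def A_RCOSETS_def'\<close>)
  define v where "v X = val_below R p m (rep X)" for X
  let ?V = "pverts ?G"
  have V: "?V = zero_divisors (R Quot I) - {\<zero>\<^bsub>R Quot I\<^esub>}"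
    by (simp add: zero_divisor_graph_def)
  have sub: "?V \<subseteq> carrier (R Quot I)" by (auto simp: V zero_divisors_def)
  have mult: "X \<otimes>\<^bsub>R Quot I\<^esub> Y = \<zero>\<^bsub>R Quot I\<^esub> \<longleftrightarrow> m \<le> v X + v Y"
    if "X \<in> ?V" "Y \<in> ?V" for X Y
  proof -
    have X: "rep X \<in> carrier R" "I +> rep X = X" and Y: "rep Y \<in> carrier R" "I +> rep Y = Y"
      using rep that sub by blast+
    have "X \<otimes>\<^bsub>R Quot I\<^esub> Y = I +> (rep X \<otimes> rep Y)"
      using Quot_mult_cosets[OF X(1) Y(1)] by (simp only: X(2) Y(2))
    then have "X \<otimes>\<^bsub>R Quot I\<^esub> Y = \<zero>\<^bsub>R Quot I\<^esub> \<longleftrightarrow> rep X \<otimes> rep Y \<in> I"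
      using X(1) Y(1) by (simp only: Quot_eq_zero_iff m_closed)
    then show ?thesis
      unfolding I[OF m_closed[OF X(1) Y(1)]] prime_pow_divides_mult_iff[OF p X(1) Y(1)] v_def .
  qed
  have arcs: "parcs ?G = {(X, Y) \<in> all_pairs ?V. m \<le> v X + v Y}"
    using mult by (auto simp: zero_divisor_graph_def all_pairs_def)
  have "?G = threshold_graph ?V (\<lambda>X. real (v X)) (real m)"
  proof (rule pair_pre_digraph.equality)
    show "parcs ?G = parcs (threshold_graph ?V (\<lambda>X. real (v X)) (real m))"
      unfolding arcs by (auto simp: threshold_graph_def all_pairs_def)
  qed (simp_all add: threshold_graph_def)
  moreover have "finite ?V" using sub assms(6) finite_subset by blast
  ultimately have thr: "is_threshold_graph ?G" unfolding is_threshold_graph_def by blast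
  have "parcs ?G = all_pairs ?V \<longleftrightarrow> m \<le> 2"
  proof
    assume m: "m \<le> 2"
    have "1 \<le> v X" if "X \<in> ?V" for X
    proof -
      have X: "rep X \<in> carrier R" "I +> rep X = X" using rep that sub by blast+
      have "I +> rep X \<in> zero_divisors (R Quot I)" using that unfolding X(2) V by blast
      then obtain b where b: "b \<in> carrier R" "b \<notin> I" "rep X \<otimes> b \<in> I"
        using zero_divisors_Quot_iff X(1) by blast
      have "p [^] m divides rep X \<otimes> b" "\<not> p [^] m divides b"
        using b(3,2) unfolding I[OF b(1)] I[OF m_closed[OF X(1) b(1)]] .
      then show ?thesis
        unfolding v_def by (rule val_below_ge_1_of_divides_mult[OF p X(1) b(1)])
    qed
    \<comment> \<open>Two weights of at least 1 already reach the threshold, as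
      \<open>m \<le> 2\<close>.\<close>
    then have "m \<le> v X + v Y" if "X \<in> ?V" "Y \<in> ?V" for X Y
      using add_mono[of 1 "v X" 1 "v Y"] that m by simp
    then show "parcs ?G = all_pairs ?V"
      unfolding arcs by (auto simp only: all_pairs_def)
  next
    assume complete: "parcs ?G = all_pairs ?V"
    show "m \<le> 2"
    proof (rule ccontr)
      assume "\<not> m \<le> 2"
      then have m: "m \<ge> 3" by simp
      have pI: "p [^] k \<in> I \<longleftrightarrow> m \<le> k" for k :: nat
        unfolding I[OF nat_pow_closed[OF p(2)]] by (rule prime_pow_divides_pow_iff[OF p])
      \<comment> \<open>The element \<open>q\<close> is nonzero modulo \<open>I\<close> but killed
        by \<open>p\<close>, and it will witness that both \<open>p\<close> and
        \<open>p \<oplus> q\<close> are zero divisors. For \<open>m = 3\<close> two non-adjacent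
        vertices must both have weight 1, so the second vertex is a perturbation of \<open>p\<close>
        rather than another power of it.\<close>
      define q where "q = p [^] (m - 1)"
      have q: "q \<in> carrier R" "q \<notin> I" using p(2) pI[of "m - 1"] m by (auto simp: q_def)
      have pq: "p \<otimes> q \<in> I" using pI[of m] p(2) m
        by (simp add: q_def nat_pow_Suc2[symmetric] Suc_diff_Suc)
      have qq: "q \<otimes> q \<in> I" using pI[of "m - 1 + (m - 1)"] p(2) m
        by (simp add: q_def nat_pow_mult)
      \<comment> \<open>This is where \<open>m \<ge> 3\<close> is decisive: the exponent 2 stays
        below \<open>m\<close>.\<close>
      have pp: "p \<otimes> p \<notin> I" using pI[of 2] p(2) m by (simp add: numeral_2_eq_2)
      \<comment> \<open>Modulo \<open>I\<close> the term \<open>p \<otimes> q\<close> vanishes, so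
        this product agrees with \<open>p \<otimes> p\<close>.\<close>
      have p_pq: "p \<otimes> (p \<oplus> q) \<notin> I"
      proof
        assume "p \<otimes> (p \<oplus> q) \<in> I"
        then have "p \<otimes> (p \<oplus> q) \<ominus> p \<otimes> q \<in> I"
          using pq by (simp add: a_minus_def a_closed)
        moreover have "p \<otimes> (p \<oplus> q) \<ominus> p \<otimes> q = p \<otimes> p"
          using p(2) q(1) by algebra
        ultimately show False using pp by simp
      qed
      have "I +> p \<in> ?V"
      proof -
        have "I +> p \<in> zero_divisors (R Quot I)"
          using zero_divisors_Quot_iff p(2) q pq by blast
        moreover have "p \<notin> I" using pp p(2) I_l_closed by blast
        ultimately show ?thesis by (simp add: V Quot_eq_zero_iff p(2))
      qed
      moreover have "I +> (p \<oplus> q) \<in> ?V"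
      proof -
        have "(p \<oplus> q) \<otimes> q \<in> I"
          using pq qq p(2) q(1) by (simp add: l_distr a_closed)
        then have "I +> (p \<oplus> q) \<in> zero_divisors (R Quot I)"
          using zero_divisors_Quot_iff[of "p \<oplus> q"] p(2) q by auto
        \<comment> \<open>An ideal containing \<open>p \<oplus> q\<close> would contain its multiple
          by \<open>p\<close>, against \<open>p_pq\<close>.\<close>
        moreover have "p \<oplus> q \<notin> I" using p_pq p(2) I_l_closed by blast
        ultimately show ?thesis by (simp add: V Quot_eq_zero_iff p(2) q(1))
      qed
      \<comment> \<open>The representatives differ by \<open>q\<close>, which lies outside
        \<open>I\<close>. Distinctness matters because completeness only concerns pairs of different
        vertices.\<close>
      moreover have "I +> p \<noteq> I +> (p \<oplus> q)"
      proof
        assume "I +> p = I +> (p \<oplus> q)"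
        then have "(p \<oplus> q) \<ominus> p \<in> I"
          using p(2) q(1) by (metis add.m_closed quotient_eq_iff_same_a_r_cos ideal_axioms)
        moreover have "(p \<oplus> q) \<ominus> p = q" using p(2) q(1) by algebra
        ultimately show False using q(2) by simp
      qed
      ultimately have "(I +> p, I +> (p \<oplus> q)) \<in> parcs ?G"
        unfolding complete by (simp add: all_pairs_def)
      then have "I +> (p \<otimes> (p \<oplus> q)) = \<zero>\<^bsub>R Quot I\<^esub>"
        using p(2) q(1) by (simp add: zero_divisor_graph_def Quot_mult_cosets)
      then show False using p_pq p(2) q(1) by (simp add: Quot_eq_zero_iff)
    qed
  qed
  then show ?thesis using threshold_graph_dims[OF thr] by simp
qed

end
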